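(* Let $L\ge 0$ be an integer and let $P,Q:\mathbb{R}\to\mathbb{C}$ be functions. There exist $\boldsymbol\theta=(\theta_0,\theta_1,\ldots,\theta_L)\in\mathbb{R}^{L+1}$ and $\boldsymbol\phi=(\varphi,\phi_0,\phi_1,\ldots,\phi_L)\in\mathbb{R}^{L+2}$ such that, for all $x\in\mathbb{R}$, $$U^{WZW}_{\boldsymbol\theta,\boldsymbol\phi,L}(x)=\begin{bmatrix}P(x)&-Q(x)\\ Q^*(x)&P^*(x)\end{bmatrix}$$ if and only if $P$ and $Q$ are Laurent polynomials $P,Q\in\mathbb{C}[e^{ix/2},e^{-ix/2}]$ satisfying: 1. $\deg(P)\le L$ and $\deg(Q)\le L$; 2. $P$ and $Q$ have parity $L \bmod 2$; 3. for all $x\in\mathbb{R}$, $|P(x)|^2+|Q(x)|^2=1$.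
   Context: For $\theta\in\mathbb{R}$ define $$R_Y(\theta)=\begin{bmatrix}\cos\frac{\theta}{2}&-\sin\frac{\theta}{2}\\ \sin\frac{\theta}{2}&\cos\frac{\theta}{2}\end{bmatrix},\qquad R_Z(\theta)=\begin{bmatrix}e^{-i\theta/2}&0\\0&e^{i\theta/2}\end{bmatrix},$$ and put $W(\theta,\phi)=R_Y(\theta)R_Z(\phi)$. For an integer $L\ge0$, $\boldsymbol\theta=(\theta_0,\ldots,\theta_L)\in\mathbb{R}^{L+1}$ and $\boldsymbol\phi=(\varphi,\phi_0,\ldots,\phi_L)\in\mathbb{R}^{L+2}$, define for $x\in\mathbb{R}$ $$U^{WZW}_{\boldsymbol\theta,\boldsymbol\phi,L}(x)=R_Z(\varphi)\,W(\theta_0,\phi_0)\prod_{j=1}^{L}R_Z(x)\,W(\theta_j,\phi_j),$$ where the product is ordered from left to right with increasing $j$. An element $P\in\mathbb{C}[e^{ix/2},e^{-ix/2}]$ is a function of $x\in\mathbb{R}$ of the form $P(x)=\sum_{n=-N}^{N}p_n (e^{ix/2})^n$ for some integer $N\ge 0$ with $p_n\in\mathbb{C}$. Its degree $\deg(P)$ is the maximum of $|n|$ over all $n$ with $p_n\ne0$ (the zero polynomial satisfies every bound $\deg\le L$). $P$ has parity $0$ if $p_n=0$ for all odd $n$, and parity $1$ if $p_n=0$ for all even $n$. $P^*(x)$ denotes the complex conjugate of $P(x)$ for real $x$. *)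

theory Defs
  imports "HOL-Analysis.Analysis"
begin

definition mat2 :: "complex \<Rightarrow> complex \<Rightarrow> complex \<Rightarrow> complex \<Rightarrow> complex^2^2" where
  "mat2 a b c d = vector [vector [a, b], vector [c, d]]"

definition R_Y :: "real \<Rightarrow> complex^2^2" where
  "R_Y \<theta> = mat2 (of_real (cos (\<theta> / 2))) (- of_real (sin (\<theta> / 2)))
                (of_real (sin (\<theta> / 2))) (of_real (cos (\<theta> / 2)))"

definition R_Z :: "real \<Rightarrow> complex^2^2" where
  "R_Z \<theta> = mat2 (exp (- \<i> * of_real \<theta> / 2)) 0
                0 (exp (\<i> * of_real \<theta> / 2))"

definition W :: "real \<Rightarrow> real \<Rightarrow> complex^2^2" where
  "W \<theta> \<phi> = R_Y \<theta> ** R_Z \<phi>"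

text \<open>
  The first argument is the extra leading angle (the first entry of the tuple of length
  \<open>L + 2\<close>). The remaining angles are the values of \<open>\<theta>\<close> and \<open>\<phi>\<close> at \<open>0, \<dots>, L\<close>; values at larger
  indices are never used, so such sequences stand for tuples of length \<open>L + 1\<close>. Factors of
  larger index are multiplied on the right.
\<close>

primrec U_WZW :: "real \<Rightarrow> (nat \<Rightarrow> real) \<Rightarrow> (nat \<Rightarrow> real) \<Rightarrow> nat \<Rightarrow> real \<Rightarrow> complex^2^2" where
  "U_WZW \<phi>' \<theta> \<phi> 0 x = R_Z \<phi>' ** W (\<theta> 0) (\<phi> 0)"
| "U_WZW \<phi>' \<theta> \<phi> (Suc L) x =
     U_WZW \<phi>' \<theta> \<phi> L x ** (R_Z x ** W (\<theta> (Suc L)) (\<phi> (Suc L)))"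

definition laurent_expansion :: "(real \<Rightarrow> complex) \<Rightarrow> (int \<Rightarrow> complex) \<Rightarrow> bool" where
  "laurent_expansion P p \<longleftrightarrow>
     (\<exists>N::nat. (\<forall>n. \<bar>n\<bar> > int N \<longrightarrow> p n = 0) \<and>
        (\<forall>x. P x = (\<Sum>n = - int N..int N. p n * exp (\<i> * of_real x / 2) powi n)))"

definition laurent_polys :: "(real \<Rightarrow> complex) set" where
  "laurent_polys = {P. \<exists>p. laurent_expansion P p}"

text \<open>
  The coefficients of a Laurent polynomial are determined by the function; see
  \<open>laurent_expansion_unique\<close> and \<open>laurent_coeff_eqI\<close> below. Coefficient, degree and parity
  are only meaningful for elements of \<open>laurent_polys\<close>.
\<close>

definition laurent_coeff :: "(real \<Rightarrow> complex) \<Rightarrow> int \<Rightarrow> complex" where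
  "laurent_coeff P = (THE p. laurent_expansion P p)"

text \<open>The zero polynomial gets degree \<open>0\<close>, so that it satisfies every bound.\<close>

definition laurent_degree :: "(real \<Rightarrow> complex) \<Rightarrow> nat" where
  "laurent_degree P = Max (insert 0 {nat \<bar>n\<bar> | n. laurent_coeff P n \<noteq> 0})"

definition has_parity :: "(real \<Rightarrow> complex) \<Rightarrow> nat \<Rightarrow> bool" where
  "has_parity P k \<longleftrightarrow> (\<forall>n. n mod 2 \<noteq> int k \<longrightarrow> laurent_coeff P n = 0)"

lemma laurent_expansion_unique:
  assumes "laurent_expansion P p" "laurent_expansion P q"
  shows "p = q"
proof -
  let ?e = "\<lambda>x::real. exp (\<i> * of_real x / 2) :: complex"
  obtain N where N: "\<And>n. \<bar>n\<bar> > int N \<Longrightarrow> p n = 0"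
    "\<And>x. P x = (\<Sum>n = - int N..int N. p n * ?e x powi n)"
    using assms(1) unfolding laurent_expansion_def by blast
  obtain M where M: "\<And>n. \<bar>n\<bar> > int M \<Longrightarrow> q n = 0"
    "\<And>x. P x = (\<Sum>n = - int M..int M. q n * ?e x powi n)"
    using assms(2) unfolding laurent_expansion_def by blast
  define K where "K = max N M"
  define c where "c = (\<lambda>i. p (int i - int K) - q (int i - int K))"
  have zero: "(\<Sum>i\<le>2 * K. c i * ?e x ^ i) = 0" for x
  proof -
    have 1: "P x = (\<Sum>n = - int K..int K. p n * ?e x powi n)"
      unfolding N(2) by (rule sum.mono_neutral_left) (auto simp: K_def N(1))
    have 2: "P x = (\<Sum>n = - int K..int K. q n * ?e x powi n)"
      unfolding M(2) by (rule sum.mono_neutral_left) (auto simp: K_def M(1))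
    have "0 = ?e x ^ K * (P x - P x)" by simp
    also have "\<dots> = ?e x ^ K * (\<Sum>n = - int K..int K. (p n - q n) * ?e x powi n)"
      by (subst (1) 1, subst 2) (simp add: sum_subtractf left_diff_distrib)
    also have "\<dots> = (\<Sum>n = - int K..int K. (p n - q n) * ?e x powi (n + int K))"
      by (simp add: sum_distrib_left power_int_add mult_ac)
    also have "\<dots> = (\<Sum>i\<le>2 * K. c i * ?e x ^ i)"
      by (rule sum.reindex_bij_witness[of _ "\<lambda>i. int i - int K" "\<lambda>n. nat (n + int K)"])
         (auto simp: c_def power_int_def)
    finally show ?thesis by simp
  qed
  have "infinite {z. (\<Sum>i\<le>2 * K. c i * z ^ i) = 0}"
  proof
    assume "finite {z. (\<Sum>i\<le>2 * K. c i * z ^ i) = 0}"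
    moreover have "?e ` {0..1} \<subseteq> {z. (\<Sum>i\<le>2 * K. c i * z ^ i) = 0}"
      using zero by auto
    moreover have "inj_on ?e {0..1}"
    proof (rule inj_onI)
      fix x y :: real
      assume xy: "x \<in> {0..1}" "y \<in> {0..1}" and "?e x = ?e y"
      moreover have "?e t = cis (t / 2)" for t by (simp add: cis_conv_exp)
      ultimately have "Re (cis (x / 2)) = Re (cis (y / 2))" by simp
      then have "cos (x / 2) = cos (y / 2)" by simp
      moreover have "x / 2 \<in> {0..pi}" "y / 2 \<in> {0..pi}"
        using xy pi_gt3 by auto
      ultimately show "x = y" using cos_inj_pi[of "x / 2" "y / 2"] by simp
    qed
    ultimately have "finite {0..1::real}"
      by (meson finite_imageD finite_subset)
    then show False using infinite_Icc[of "0::real" 1] by simp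
  qed
  then have c0: "c i = 0" if "i \<le> 2 * K" for i
    using polyfun_finite_roots[of c "2 * K"] that by blast
  show "p = q"
  proof
    fix n
    show "p n = q n"
    proof (cases "\<bar>n\<bar> \<le> int K")
      case True
      then have "c (nat (n + int K)) = 0" by (intro c0) auto
      moreover have "int (nat (n + int K)) - int K = n" using True by linarith
      ultimately show ?thesis by (simp add: c_def)
    next
      case False
      then show ?thesis using N(1)[of n] M(1)[of n] by (simp add: K_def)
    qed
  qed
qed

lemma laurent_coeff_eqI: "laurent_expansion P p \<Longrightarrow> laurent_coeff P = p"
  unfolding laurent_coeff_def by (blast intro: laurent_expansion_unique)

lemma laurent_coeff_expansion: "P \<in> laurent_polys \<Longrightarrow> laurent_expansion P (laurent_coeff P)"
  unfolding laurent_polys_def by (auto simp: laurent_coeff_eqI)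

lemma laurent_degree_le_iff:
  assumes "P \<in> laurent_polys"
  shows "laurent_degree P \<le> L \<longleftrightarrow> (\<forall>n. \<bar>n\<bar> > int L \<longrightarrow> laurent_coeff P n = 0)"
proof -
  obtain N where N: "\<And>n. \<bar>n\<bar> > int N \<Longrightarrow> laurent_coeff P n = 0"
    using laurent_coeff_expansion[OF assms] unfolding laurent_expansion_def by blast
  have "{n. laurent_coeff P n \<noteq> 0} \<subseteq> {- int N..int N}"
  proof
    fix n assume "n \<in> {n. laurent_coeff P n \<noteq> 0}"
    then have "\<not> \<bar>n\<bar> > int N" using N by blast
    then show "n \<in> {- int N..int N}" by auto
  qed
  then have "finite {n. laurent_coeff P n \<noteq> 0}"
    using finite_subset by blast
  then have "finite {nat \<bar>n\<bar> | n. laurent_coeff P n \<noteq> 0}"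
    by (rule finite_image_set)
  then have "laurent_degree P \<le> L \<longleftrightarrow> (\<forall>n. laurent_coeff P n \<noteq> 0 \<longrightarrow> nat \<bar>n\<bar> \<le> L)"
    unfolding laurent_degree_def by auto
  moreover have "nat \<bar>n\<bar> \<le> L \<longleftrightarrow> \<not> int L < \<bar>n\<bar>" for n by linarith
  ultimately show ?thesis by metis
qed

end

theory Submission
  imports Defs "HOL-Computational_Algebra.Polynomial"
begin

text \<open>
  All factors lie in \<open>SU(2)\<close>, so only first rows matter. With \<open>z = e\<^sup>i\<^sup>x\<close>, the admissible Laurent
  polynomials at level \<open>L\<close> are exactly \<open>e\<^sup>-\<^sup>i\<^sup>L\<^sup>x\<^sup>/\<^sup>2 A(z)\<close> for polynomials \<open>A\<close> of degree at most \<open>L\<close>, and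
  multiplication by \<open>R_Z x ** W \<theta> \<phi>\<close>, where \<open>W \<theta> \<phi>\<close> has first row \<open>(u, v)\<close>, sends \<open>(A, B)\<close> to
  \<open>(u A - cnj v z B, v A + cnj u z B)\<close>. Conversely, such a layer can be stripped from a pair \<open>(A, B)\<close> of
  level \<open>L + 1\<close> provided \<open>cnj u A + cnj v B\<close> has no top coefficient and \<open>u B - v A\<close> no constant one.
  The identity \<open>\<bar>A\<bar>\<^sup>2 + \<bar>B\<bar>\<^sup>2 = 1\<close> on the circle makes the vectors of constant and of top
  coefficients orthogonal, so that both conditions hold for a common unit vector \<open>(u, v)\<close>.
\<close>

section \<open>First rows\<close>

text \<open>The lower row is determined by the upper one. Unit length of \<open>(a, b)\<close> is
  not built in; it is tracked by separate norm identities.\<close>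

definition su2 :: "complex \<Rightarrow> complex \<Rightarrow> complex^2^2" where
  "su2 a b = mat2 a b (- cnj b) (cnj a)"

lemma mat2_mult:
  "mat2 a b c d ** mat2 a' b' c' d' =
     mat2 (a * a' + b * c') (a * b' + b * d') (c * a' + d * c') (c * b' + d * d')"
  by (simp add: mat2_def vec_eq_iff matrix_matrix_mult_def forall_2 sum_2)

lemma su2_mult: "su2 a b ** su2 c d = su2 (a * c - b * cnj d) (a * d + b * cnj c)"
  by (simp add: su2_def mat2_mult algebra_simps)

lemma su2_eq_iff: "su2 a b = su2 c d \<longleftrightarrow> a = c \<and> b = d"
  by (auto simp: su2_def mat2_def vec_eq_iff forall_2)

lemma R_Z_su2: "R_Z x = su2 (cis (- x / 2)) 0"
  by (simp add: R_Z_def su2_def cis_conv_exp cis_cnj exp_cnj)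

lemma W_su2:
  "W \<theta> \<phi> = su2 (of_real (cos (\<theta> / 2)) * cis (- \<phi> / 2)) (- of_real (sin (\<theta> / 2)) * cis (\<phi> / 2))"
proof -
  have "R_Y \<theta> = su2 (of_real (cos (\<theta> / 2))) (- of_real (sin (\<theta> / 2)))"
    by (simp add: R_Y_def su2_def)
  then show ?thesis
    by (simp add: W_def R_Z_su2 su2_mult cis_cnj)
qed

lemma cmod_sq_sum_eq_iff:
  "(cmod a)\<^sup>2 + (cmod b)\<^sup>2 = r \<longleftrightarrow> a * cnj a + b * cnj b = of_real r"
  by (metis complex_norm_square of_real_add of_real_eq_iff)

lemma W_row_unit:
  "(cmod (of_real (cos (\<theta> / 2)) * cis (- \<phi> / 2)))\<^sup>2 +
   (cmod (- of_real (sin (\<theta> / 2)) * cis (\<phi> / 2)))\<^sup>2 = 1"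
  by (simp add: norm_mult)

text \<open>A first row of \<open>W\<close> has two real parameters, a unit vector in complex
  2-space has three; the common phase \<delta> makes up the difference.\<close>

lemma unit_pair_angles:
  assumes "(cmod u)\<^sup>2 + (cmod v)\<^sup>2 = 1"
  obtains \<delta> \<theta> \<phi> where
    "u = cis \<delta> * (of_real (cos (\<theta> / 2)) * cis (- \<phi> / 2))"
    "v = cis \<delta> * (- of_real (sin (\<theta> / 2)) * cis (\<phi> / 2))"
proof -
  \<comment> \<open>The negative sine matches the minus sign in the second entry of the row of
    \<open>W\<close>.\<close>
  obtain t where t: "cmod u = cos t" "- cmod v = sin t"
    using sincos_total_2pi[of "cmod u" "- cmod v"] assms by auto
  define \<alpha> \<beta> where "\<alpha> = Arg u" and "\<beta> = Arg v"
  have u: "u = of_real (cos t) * cis \<alpha>" and v: "v = - of_real (sin t) * cis \<beta>"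
    using rcis_cmod_Arg[of u] rcis_cmod_Arg[of v]
    by (simp_all add: rcis_def \<alpha>_def \<beta>_def t(1) flip: t(2))
  show ?thesis
  proof (rule that)
    \<comment> \<open>The choice \<delta> = (\<alpha> + \<beta>) / 2, \<phi> = \<beta> - \<alpha>
      solves \<delta> - \<phi> / 2 = \<alpha> and \<delta> + \<phi> / 2 = \<beta>.\<close>
    have "(\<alpha> + \<beta>) / 2 + - (\<beta> - \<alpha>) / 2 = \<alpha>" "(\<alpha> + \<beta>) / 2 + (\<beta> - \<alpha>) / 2 = \<beta>"
      by (simp_all add: field_simps)
    then have *: "cis ((\<alpha> + \<beta>) / 2) * cis (- (\<beta> - \<alpha>) / 2) = cis \<alpha>"
      "cis ((\<alpha> + \<beta>) / 2) * cis ((\<beta> - \<alpha>) / 2) = cis \<beta>"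
      by (simp_all only: cis_mult)
    show "u = cis ((\<alpha> + \<beta>) / 2) * (of_real (cos ((2 * t) / 2)) * cis (- (\<beta> - \<alpha>) / 2))"
      unfolding u *(1)[symmetric] by simp
    show "v = cis ((\<alpha> + \<beta>) / 2) * (- of_real (sin ((2 * t) / 2)) * cis ((\<beta> - \<alpha>) / 2))"
      unfolding v *(2)[symmetric] by simp
  qed
qed

section \<open>Laurent polynomials of given degree and parity\<close>

text \<open>The support condition leaves only n = 2k - L with 0 \<le> k \<le> L, and there
  \<open>cis (x / 2)\<close> to the power n is
  \<open>cis (- (real L * x / 2)) * cis x ^ k\<close>.\<close>

lemma sum_parity_support:
  fixes p :: "int \<Rightarrow> complex"
  assumes "\<And>n. p n \<noteq> 0 \<Longrightarrow> \<bar>n\<bar> \<le> int L \<and> n mod 2 = int L mod 2 \<and> \<bar>n\<bar> \<le> int N"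
  shows "(\<Sum>n = - int N..int N. p n * cis (x / 2) powi n) =
    cis (- (real L * x / 2)) * (\<Sum>k\<le>L. p (2 * int k - int L) * cis x ^ k)"
proof -
  let ?f = "\<lambda>n. p n * cis (x / 2) powi n"
  have "(\<Sum>n = - int N..int N. ?f n) = (\<Sum>n \<in> {n. p n \<noteq> 0}. ?f n)"
    using assms by (intro sum.mono_neutral_right) (force simp: abs_le_iff)+
  also have "\<dots> = (\<Sum>n \<in> (\<lambda>k. 2 * int k - int L) ` {..L}. ?f n)"
  proof (intro sum.mono_neutral_left)
    show "{n. p n \<noteq> 0} \<subseteq> (\<lambda>k. 2 * int k - int L) ` {..L}"
    proof
      fix n assume "n \<in> {n. p n \<noteq> 0}"
      with assms have "\<bar>n\<bar> \<le> int L" "n mod 2 = int L mod 2" by auto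
      moreover from this have "2 * ((n + int L) div 2) = n + int L" by presburger
      ultimately have "n = 2 * int (nat ((n + int L) div 2)) - int L" "nat ((n + int L) div 2) \<le> L"
        by linarith+
      then show "n \<in> (\<lambda>k. 2 * int k - int L) ` {..L}" by blast
    qed
  qed auto
  also have "\<dots> = (\<Sum>k\<le>L. ?f (2 * int k - int L))"
    by (subst sum.reindex) (auto simp: inj_on_def)
  also have "\<dots> = (\<Sum>k\<le>L. cis (- (real L * x / 2)) * (p (2 * int k - int L) * cis x ^ k))"
  proof (intro sum.cong refl)
    fix k
    have "cis (x / 2) powi (2 * int k - int L) = cis (- (real L * x / 2)) * cis x ^ k"
      unfolding cis_power_int Complex.DeMoivre cis_mult
      by (intro arg_cong[of _ _ cis]) (simp add: field_simps)
    then show "?f (2 * int k - int L) = cis (- (real L * x / 2)) * (p (2 * int k - int L) * cis x ^ k)"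
      by simp
  qed
  finally show ?thesis by (simp add: sum_distrib_left)
qed

lemma laurent_poly_form_iff:
  "P \<in> laurent_polys \<and> laurent_degree P \<le> L \<and> has_parity P (L mod 2) \<longleftrightarrow>
   (\<exists>A. degree A \<le> L \<and> (\<forall>x. P x = cis (- (real L * x / 2)) * poly A (cis x)))"
proof
  assume "P \<in> laurent_polys \<and> laurent_degree P \<le> L \<and> has_parity P (L mod 2)"
  then have P: "P \<in> laurent_polys" "laurent_degree P \<le> L" "has_parity P (L mod 2)"
    by auto
  define p where "p = laurent_coeff P"
  obtain N where N: "\<And>n. \<bar>n\<bar> > int N \<Longrightarrow> p n = 0"
    "\<And>x. P x = (\<Sum>n = - int N..int N. p n * exp (\<i> * of_real x / 2) powi n)"
    using laurent_coeff_expansion[OF P(1)] unfolding laurent_expansion_def p_def by blast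
  have supp: "\<bar>n\<bar> \<le> int L \<and> n mod 2 = int L mod 2 \<and> \<bar>n\<bar> \<le> int N" if "p n \<noteq> 0" for n
    using that P(3) laurent_degree_le_iff[OF P(1), of L] P(2) N(1)[of n]
    unfolding has_parity_def p_def by (metis linorder_not_le zmod_int of_nat_numeral)
  define A where "A = (\<Sum>k\<le>L. monom (p (2 * int k - int L)) k)"
  have "degree A \<le> L"
    unfolding A_def by (intro degree_sum_le) (auto intro: order.trans[OF degree_monom_le])
  moreover have "P x = cis (- (real L * x / 2)) * poly A (cis x)" for x
    using N(2)[of x] sum_parity_support[of p L N x, OF supp]
    by (simp add: A_def poly_sum poly_monom cis_conv_exp)
  ultimately show "\<exists>A. degree A \<le> L \<and> (\<forall>x. P x = cis (- (real L * x / 2)) * poly A (cis x))"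
    by blast
next
  assume "\<exists>A. degree A \<le> L \<and> (\<forall>x. P x = cis (- (real L * x / 2)) * poly A (cis x))"
  then obtain A where A: "degree A \<le> L" "\<And>x. P x = cis (- (real L * x / 2)) * poly A (cis x)"
    by blast
  \<comment> \<open>This inverts the index change n = 2k - L; indices out of range or of the wrong
    parity get 0.\<close>
  define p where "p n = (if \<bar>n\<bar> \<le> int L \<and> n mod 2 = int L mod 2
    then coeff A (nat ((n + int L) div 2)) else 0)" for n
  have supp: "\<bar>n\<bar> \<le> int L \<and> n mod 2 = int L mod 2 \<and> \<bar>n\<bar> \<le> int L" if "p n \<noteq> 0" for n
    using that by (auto simp: p_def split: if_splits)
  have p: "p (2 * int k - int L) = coeff A k" if "k \<le> L" for k
  proof -
    have "(2 * int k - int L) mod 2 = int L mod 2" by presburger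
    then show ?thesis using that by (simp add: p_def)
  qed
  have "poly A z = (\<Sum>k\<le>L. coeff A k * z ^ k)" for z
    unfolding poly_altdef using A(1)
    by (intro sum.mono_neutral_left) (auto simp: coeff_eq_0)
  then have "P x = (\<Sum>n = - int L..int L. p n * exp (\<i> * of_real x / 2) powi n)" for x
    using A(2)[of x] sum_parity_support[of p L L x, OF supp]
    by (simp add: p cis_conv_exp)
  then have exp: "laurent_expansion P p"
    unfolding laurent_expansion_def by (intro exI[of _ L]) (auto simp: p_def)
  then have P: "P \<in> laurent_polys" and c: "laurent_coeff P = p"
    by (auto simp: laurent_polys_def laurent_coeff_eqI)
  have "laurent_degree P \<le> L"
    unfolding laurent_degree_le_iff[OF P] c by (auto simp: p_def)
  moreover have "has_parity P (L mod 2)"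
    unfolding has_parity_def c by (auto simp: p_def zmod_int)
  ultimately show "P \<in> laurent_polys \<and> laurent_degree P \<le> L \<and> has_parity P (L mod 2)"
    using P by blast
qed

section \<open>Adding and stripping a layer\<close>

lemma U_WZW_cong:
  assumes "\<And>j. j \<le> L \<Longrightarrow> \<theta> j = \<theta>' j" "\<And>j. j \<le> L \<Longrightarrow> \<phi> j = \<phi>' j"
  shows "U_WZW \<psi> \<theta> \<phi> L x = U_WZW \<psi> \<theta>' \<phi>' L x"
  using assms by (induction L) auto

text \<open>The diagonal of \<open>R_Z x\<close> is \<open>cis (- x / 2)\<close> times (1,
  \<open>cis x\<close>). The common factor turns L into \<open>Suc L\<close> in the prefactor, and
  \<open>cis x\<close> stays with \<open>b\<close>.\<close>

lemma su2_layer: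
  "su2 (cis (- (real L * x / 2)) * a) (cis (- (real L * x / 2)) * b) ** (R_Z x ** su2 u v) =
   su2 (cis (- (real (Suc L) * x / 2)) * (u * a - cnj v * (cis x * b)))
       (cis (- (real (Suc L) * x / 2)) * (v * a + cnj u * (cis x * b)))"
proof -
  have *: "cis (- (real (Suc L) * x / 2)) = cis (- (real L * x / 2)) * cis (- x / 2)"
    by (simp add: cis_mult algebra_simps add_divide_distrib diff_divide_distrib)
  have "cis x = cis (x / 2) * cis (x / 2)" "cis (- x / 2) * cis (x / 2) = 1"
    by (simp_all add: cis_mult)
  then have **: "cis (- x / 2) * cis x = cis (x / 2)"
    by (metis mult.assoc mult_1)
  show ?thesis
    unfolding R_Z_su2 su2_mult su2_eq_iff *
    by (auto simp: algebra_simps cis_cnj simp flip: **)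
qed

text \<open>The matrix with columns \<open>(u, v)\<close> and \<open>(- cnj v, cnj u)\<close> is
  unitary.\<close>

lemma layer_norm:
  assumes "(cmod u)\<^sup>2 + (cmod v)\<^sup>2 = 1"
  shows "(cmod (u * a - cnj v * b))\<^sup>2 + (cmod (v * a + cnj u * b))\<^sup>2 = (cmod a)\<^sup>2 + (cmod b)\<^sup>2"
proof -
  have uv: "u * cnj u + v * cnj v = 1"
    using assms unfolding cmod_sq_sum_eq_iff by simp
  have "(u * a - cnj v * b) * cnj (u * a - cnj v * b) + (v * a + cnj u * b) * cnj (v * a + cnj u * b)
      = (u * cnj u + v * cnj v) * (a * cnj a + b * cnj b)"
    by (simp add: algebra_simps)
  also have "\<dots> = of_real ((cmod a)\<^sup>2 + (cmod b)\<^sup>2)"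
    using cmod_sq_sum_eq_iff[of a b "(cmod a)\<^sup>2 + (cmod b)\<^sup>2"] by (simp add: uv)
  finally show ?thesis
    unfolding cmod_sq_sum_eq_iff .
qed

text \<open>The induction carries the unit-norm identity along with the degree bounds; a layer
  preserves it because the extra factor \<open>cis x\<close> has modulus 1.\<close>

lemma U_WZW_form:
  "\<exists>A B. degree A \<le> L \<and> degree B \<le> L \<and>
     (\<forall>x. (cmod (poly A (cis x)))\<^sup>2 + (cmod (poly B (cis x)))\<^sup>2 = 1) \<and>
     (\<forall>x. U_WZW \<psi> \<theta> \<phi> L x =
        su2 (cis (- (real L * x / 2)) * poly A (cis x)) (cis (- (real L * x / 2)) * poly B (cis x)))"
proof (induction L)
  case 0
  define u v where "u = of_real (cos (\<theta> 0 / 2)) * cis (- \<phi> 0 / 2)"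
    and "v = - of_real (sin (\<theta> 0 / 2)) * cis (\<phi> 0 / 2)"
  have "(cmod u)\<^sup>2 + (cmod v)\<^sup>2 = 1"
    unfolding u_def v_def by (rule W_row_unit)
  then have "(cmod (cis (- \<psi> / 2) * u))\<^sup>2 + (cmod (cis (- \<psi> / 2) * v))\<^sup>2 = 1"
    by (simp add: norm_mult)
  moreover have "U_WZW \<psi> \<theta> \<phi> 0 x = su2 (cis (- \<psi> / 2) * u) (cis (- \<psi> / 2) * v)" for x
    by (simp add: W_su2 R_Z_su2 su2_mult u_def v_def)
  ultimately show ?case
    by - (rule exI[of _ "[:cis (- \<psi> / 2) * u:]"], rule exI[of _ "[:cis (- \<psi> / 2) * v:]"],
       simp del: U_WZW.simps)
next
  case (Suc L)
  then obtain A B where AB: "degree A \<le> L" "degree B \<le> L"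
    "\<And>x. (cmod (poly A (cis x)))\<^sup>2 + (cmod (poly B (cis x)))\<^sup>2 = 1"
    "\<And>x. U_WZW \<psi> \<theta> \<phi> L x =
        su2 (cis (- (real L * x / 2)) * poly A (cis x)) (cis (- (real L * x / 2)) * poly B (cis x))"
    by blast
  define u v where "u = of_real (cos (\<theta> (Suc L) / 2)) * cis (- \<phi> (Suc L) / 2)"
    and "v = - of_real (sin (\<theta> (Suc L) / 2)) * cis (\<phi> (Suc L) / 2)"
  have uv: "(cmod u)\<^sup>2 + (cmod v)\<^sup>2 = 1"
    unfolding u_def v_def by (rule W_row_unit)
  \<comment> \<open>\<open>pCons 0\<close> is multiplication by z, so this is the update of
    \<open>su2_layer\<close> at the level of polynomials.\<close>
  define A' B' where "A' = smult u A - smult (cnj v) (pCons 0 B)"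
    and "B' = smult v A + smult (cnj u) (pCons 0 B)"
  have ev: "poly A' z = u * poly A z - cnj v * (z * poly B z)"
    "poly B' z = v * poly A z + cnj u * (z * poly B z)" for z
    by (simp_all add: A'_def B'_def)
  have "degree (smult c A) \<le> Suc L" "degree (smult c (pCons 0 B)) \<le> Suc L" for c
    using AB(1,2) by (auto intro!: order.trans[OF degree_smult_le] order.trans[OF degree_pCons_le])
  then have "degree A' \<le> Suc L" "degree B' \<le> Suc L"
    unfolding A'_def B'_def by (blast intro: degree_diff_le degree_add_le)+
  moreover have "(cmod (poly A' (cis x)))\<^sup>2 + (cmod (poly B' (cis x)))\<^sup>2 = 1" for x
    unfolding ev layer_norm[OF uv] using AB(3)[of x] by (simp add: norm_mult)
  moreover have "U_WZW \<psi> \<theta> \<phi> (Suc L) x =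
      su2 (cis (- (real (Suc L) * x / 2)) * poly A' (cis x))
          (cis (- (real (Suc L) * x / 2)) * poly B' (cis x))" for x
    unfolding U_WZW.simps AB(4) W_su2 ev u_def v_def by (rule su2_layer)
  ultimately show ?case by blast
qed

section \<open>Orthogonality of constant and top coefficients\<close>

lemma circle_infinite: "infinite {z. cmod z = 1}"
proof
  assume "finite {z. cmod z = 1}"
  moreover have "cis ` {0..1} \<subseteq> {z. cmod z = 1}" by auto
  ultimately have "finite (cis ` {0..1})" by (rule rev_finite_subset)
  moreover have "inj_on cis {0..1}"
  proof (rule inj_onI)
    fix x y :: real
    assume "x \<in> {0..1}" "y \<in> {0..1}" "cis x = cis y"
    moreover have "cos x = cos y" using \<open>cis x = cis y\<close> by (metis cis.sel(1))
    ultimately show "x = y" using cos_inj_pi[of x y] pi_gt3 by simp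
  qed
  ultimately have "finite {0..1::real}" by (rule finite_imageD)
  then show False using infinite_Icc[of "0::real" 1] by simp
qed

text \<open>For \<open>degree A \<le> n\<close> this is the conjugate reciprocal polynomial z^n cnj
  (A (1 / cnj z)); n is explicit because the degree of A may be smaller.\<close>

definition conj_reflect :: "nat \<Rightarrow> complex poly \<Rightarrow> complex poly" where
  "conj_reflect n A = (\<Sum>k\<le>n. monom (cnj (coeff A k)) (n - k))"

lemma poly_conj_reflect_0: "poly (conj_reflect n A) 0 = cnj (coeff A n)"
proof -
  have "poly (conj_reflect n A) 0 = (\<Sum>k\<le>n. if k = n then cnj (coeff A k) else 0)"
    unfolding conj_reflect_def poly_sum poly_monom
    by (intro sum.cong) (auto simp: power_0_left)
  then show ?thesis by simp
qed

text \<open>On the unit circle cnj z = 1 / z, so conjugation becomes polynomial after multiplication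
  by z^n.\<close>

lemma poly_conj_reflect_circle:
  assumes "cmod z = 1" "degree A \<le> n"
  shows "poly (conj_reflect n A) z = z ^ n * cnj (poly A z)"
proof -
  have z: "z * cnj z = 1"
    using assms(1) complex_norm_square[of z] by simp
  have "poly A z = (\<Sum>k\<le>n. coeff A k * z ^ k)"
    unfolding poly_altdef using assms(2)
    by (intro sum.mono_neutral_left) (auto simp: coeff_eq_0)
  then have "z ^ n * cnj (poly A z) = (\<Sum>k\<le>n. cnj (coeff A k) * (z ^ n * cnj z ^ k))"
    by (simp add: sum_distrib_left mult_ac)
  also have "\<dots> = (\<Sum>k\<le>n. cnj (coeff A k) * z ^ (n - k))"
  proof (intro sum.cong refl)
    fix k assume "k \<in> {..n}"
    then have "z ^ n = z ^ (n - k) * z ^ k"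
      by (simp flip: power_add)
    moreover have "z ^ k * cnj z ^ k = 1"
      by (simp add: z flip: power_mult_distrib)
    ultimately show "cnj (coeff A k) * (z ^ n * cnj z ^ k) = cnj (coeff A k) * z ^ (n - k)"
      by (simp add: mult.assoc)
  qed
  finally show ?thesis
    by (simp add: conj_reflect_def poly_sum poly_monom)
qed

text \<open>Multiplied by z^n, the norm identity becomes a polynomial identity valid at infinitely
  many points, hence everywhere. At 0 the term z^n vanishes since n > 0, and the constant
  coefficients remain.\<close>

lemma extreme_coeffs_orthogonal:
  assumes deg: "degree A \<le> n" "degree B \<le> n" and "n > 0"
    and unit: "\<And>z. cmod z = 1 \<Longrightarrow> (cmod (poly A z))\<^sup>2 + (cmod (poly B z))\<^sup>2 = 1"
  shows "coeff A 0 * cnj (coeff A n) + coeff B 0 * cnj (coeff B n) = 0"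
proof -
  let ?R = "A * conj_reflect n A + B * conj_reflect n B - monom 1 n"
  have "poly ?R z = 0" if "cmod z = 1" for z
  proof -
    have "poly ?R z = z ^ n * (poly A z * cnj (poly A z) + poly B z * cnj (poly B z) - 1)"
      by (simp add: poly_conj_reflect_circle that deg poly_monom algebra_simps)
    also have "\<dots> = 0"
      using unit[OF that] unfolding cmod_sq_sum_eq_iff by simp
    finally show ?thesis .
  qed
  then have "{z. cmod z = 1} \<subseteq> {z. poly ?R z = 0}" by blast
  then have "?R = 0"
    using circle_infinite poly_roots_finite[of ?R] finite_subset by metis
  then have "poly ?R 0 = 0" by (simp only: poly_0)
  then have "poly A 0 * cnj (coeff A n) + poly B 0 * cnj (coeff B n) = 0"
    using \<open>n > 0\<close> by (simp only: poly_diff poly_add poly_mult poly_conj_reflect_0 poly_monom) simp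
  then show ?thesis
    by (simp only: poly_0_coeff_0)
qed

section \<open>Stripping the last layer\<close>

lemma unit_pair_proportional:
  assumes "a \<noteq> 0 \<or> b \<noteq> (0 :: complex)"
  obtains u v c where "c \<noteq> 0" "u = c * a" "v = c * b" "(cmod u)\<^sup>2 + (cmod v)\<^sup>2 = 1"
proof -
  define r where "r = (cmod a)\<^sup>2 + (cmod b)\<^sup>2"
  have r: "r > 0"
    using assms unfolding r_def by (auto simp: add_pos_nonneg add_nonneg_pos)
  define c :: complex where "c = of_real (1 / sqrt r)"
  have "(cmod (c * a))\<^sup>2 + (cmod (c * b))\<^sup>2 = (cmod c)\<^sup>2 * r"
    by (simp add: norm_mult power_mult_distrib r_def algebra_simps)
  also have "\<dots> = 1"
    using r unfolding c_def norm_of_real by (simp add: power_divide)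
  finally show ?thesis
    using r by (intro that[of c]) (auto simp: c_def)
qed

text \<open>The vector \<open>(u, v)\<close> must be parallel to \<open>(a0, b0)\<close> and
  orthogonal to \<open>(a1, b1)\<close>; the hypothesis makes the two demands compatible.\<close>

lemma strip_direction:
  assumes "a0 * cnj a1 + b0 * cnj b1 = 0"
  obtains u v where "(cmod u)\<^sup>2 + (cmod v)\<^sup>2 = 1"
    "cnj u * a1 + cnj v * b1 = 0" "u * b0 - v * a0 = 0"
proof -
  consider "a0 \<noteq> 0 \<or> b0 \<noteq> 0" | "a0 = 0" "b0 = 0" "cnj b1 \<noteq> 0 \<or> - cnj a1 \<noteq> 0"
    | "a0 = 0" "b0 = 0" "a1 = 0" "b1 = 0" by auto
  then show ?thesis
  proof cases
    case 1
    then obtain u v c where uv: "u = c * a0" "v = c * b0" "(cmod u)\<^sup>2 + (cmod v)\<^sup>2 = 1"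
      by (rule unit_pair_proportional)
    have "cnj (c * (a0 * cnj a1 + b0 * cnj b1)) = 0"
      using assms by simp
    then show ?thesis
      using uv by (intro that[of u v]) (auto simp: algebra_simps)
  next
    case 2
    \<comment> \<open>With \<open>(a0, b0)\<close> zero only orthogonality to
      \<open>(a1, b1)\<close> is left, and \<open>(cnj b1, - cnj a1)\<close> has it.\<close>
    from 2(3) obtain u v c where uv: "u = c * cnj b1" "v = c * - cnj a1" "(cmod u)\<^sup>2 + (cmod v)\<^sup>2 = 1"
      by (rule unit_pair_proportional)
    then show ?thesis
      using 2 by (intro that[of u v]) auto
  next
    case 3
    then show ?thesis by (intro that[of 1 0]) auto
  qed
qed

text \<open>The inverse unitary map yields C and E = z D. The vanishing top coefficient lowers the
  degree of C; the vanishing constant one lets z be divided out of E.\<close>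

lemma strip_layer:
  assumes deg: "degree A \<le> Suc L" "degree B \<le> Suc L"
    and unit: "\<And>z. cmod z = 1 \<Longrightarrow> (cmod (poly A z))\<^sup>2 + (cmod (poly B z))\<^sup>2 = 1"
  obtains \<theta> \<phi> u v C D where "W \<theta> \<phi> = su2 u v" "degree C \<le> L" "degree D \<le> L"
    "\<And>z. cmod z = 1 \<Longrightarrow> (cmod (poly C z))\<^sup>2 + (cmod (poly D z))\<^sup>2 = 1"
    "\<And>z. poly A z = u * poly C z - cnj v * (z * poly D z)"
    "\<And>z. poly B z = v * poly C z + cnj u * (z * poly D z)"
proof -
  obtain u' v' where uv': "(cmod u')\<^sup>2 + (cmod v')\<^sup>2 = 1"
    "cnj u' * coeff A (Suc L) + cnj v' * coeff B (Suc L) = 0" "u' * coeff B 0 - v' * coeff A 0 = 0"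
    using strip_direction[OF extreme_coeffs_orthogonal[OF deg _ unit]] by blast
  obtain \<delta> \<theta> \<phi> where \<delta>: "u' = cis \<delta> * (of_real (cos (\<theta> / 2)) * cis (- \<phi> / 2))"
    "v' = cis \<delta> * (- of_real (sin (\<theta> / 2)) * cis (\<phi> / 2))"
    using unit_pair_angles[OF uv'(1)] by blast
  define u v where "u = of_real (cos (\<theta> / 2)) * cis (- \<phi> / 2)"
    and "v = - of_real (sin (\<theta> / 2)) * cis (\<phi> / 2)"
  have u': "u' = cis \<delta> * u" "v' = cis \<delta> * v"
    using \<delta> unfolding u_def v_def by auto
  have norm: "(cmod u)\<^sup>2 + (cmod v)\<^sup>2 = 1"
    unfolding u_def v_def by (rule W_row_unit)
  then have uv: "u * cnj u + v * cnj v = 1"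
    unfolding cmod_sq_sum_eq_iff by simp
  define C where "C = smult (cnj u) A + smult (cnj v) B"
  define E where "E = smult u B - smult v A"
  \<comment> \<open>Both conditions are homogeneous in \<open>(u', v')\<close>, so they survive
    dropping the phase \<delta>, which the layer itself cannot produce.\<close>
  have "cnj (cis \<delta>) * coeff C (Suc L) = 0" "cis \<delta> * coeff E 0 = 0"
    using uv'(2,3) by (simp_all add: C_def E_def u' algebra_simps)
  then have coeffs: "coeff C (Suc L) = 0" "coeff E 0 = 0"
    by auto
  have dsm: "degree (smult c A) \<le> Suc L" "degree (smult c B) \<le> Suc L" for c
    using deg by (auto intro: order.trans[OF degree_smult_le])
  then have dC: "degree C \<le> Suc L" and dE: "degree E \<le> Suc L"
    unfolding C_def E_def by (blast intro: degree_diff_le degree_add_le)+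
  have C: "degree C \<le> L"
    using eq_zero_or_degree_less[OF dC coeffs(1)] by auto
  obtain e D where "E = pCons e D" by (cases E)
  then have E: "E = pCons 0 D" using coeffs(2) by simp
  then have D: "degree D \<le> L"
    using dE by (cases "D = 0") auto
  have evC: "poly C z = cnj u * poly A z + cnj v * poly B z" for z
    by (simp add: C_def)
  have evD: "z * poly D z = u * poly B z - v * poly A z" for z
    using arg_cong[OF E, of "\<lambda>p. poly p z"] by (simp add: E_def)
  have 1: "poly A z = u * poly C z - cnj v * (z * poly D z)" for z
  proof -
    have "u * poly C z - cnj v * (z * poly D z) = (u * cnj u + v * cnj v) * poly A z"
      unfolding evC evD by (simp add: algebra_simps)
    then show ?thesis by (simp add: uv)
  qed
  have 2: "poly B z = v * poly C z + cnj u * (z * poly D z)" for z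
  proof -
    have "v * poly C z + cnj u * (z * poly D z) = (u * cnj u + v * cnj v) * poly B z"
      unfolding evC evD by (simp add: algebra_simps)
    then show ?thesis by (simp add: uv)
  qed
  \<comment> \<open>\<open>layer_norm\<close> is read backwards, from (A, B) to (C, z D).\<close>
  have "(cmod (poly C z))\<^sup>2 + (cmod (poly D z))\<^sup>2 = 1" if "cmod z = 1" for z
    using layer_norm[OF norm, of "poly C z" "z * poly D z"] unit[OF that] that
    unfolding 1[symmetric] 2[symmetric] by (simp add: norm_mult)
  then show ?thesis
    using C D 1 2 by (intro that[of \<theta> \<phi> u v C D]) (auto simp: W_su2 u_def v_def)
qed

section \<open>Existence of the angles\<close>

lemma U_WZW_exists:
  assumes "degree A \<le> L" "degree B \<le> L"
    and "\<And>z. cmod z = 1 \<Longrightarrow> (cmod (poly A z))\<^sup>2 + (cmod (poly B z))\<^sup>2 = 1"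
  shows "\<exists>\<theta> \<psi> \<phi>. \<forall>x. U_WZW \<psi> \<theta> \<phi> L x =
    su2 (cis (- (real L * x / 2)) * poly A (cis x)) (cis (- (real L * x / 2)) * poly B (cis x))"
  using assms
proof (induction L arbitrary: A B)
  case 0
  then obtain a b where ab: "A = [:a:]" "B = [:b:]"
    by (metis degree_eq_zeroE le_zero_eq)
  then have "(cmod a)\<^sup>2 + (cmod b)\<^sup>2 = 1"
    using "0.prems"(3)[of 1] by simp
  then obtain \<delta> \<theta> \<phi> where \<delta>: "a = cis \<delta> * (of_real (cos (\<theta> / 2)) * cis (- \<phi> / 2))"
    "b = cis \<delta> * (- of_real (sin (\<theta> / 2)) * cis (\<phi> / 2))"
    by (rule unit_pair_angles)
  \<comment> \<open>The leading rotation by \<open>- 2 * \<delta>\<close> is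
    \<open>su2 (cis \<delta>) 0\<close> and supplies the phase missing from
    \<open>W\<close>.\<close>
  show ?case
    by (rule exI[of _ "\<lambda>_. \<theta>"], rule exI[of _ "- 2 * \<delta>"], rule exI[of _ "\<lambda>_. \<phi>"])
       (simp add: W_su2 R_Z_su2 su2_mult ab \<delta>)
next
  case (Suc L)
  from strip_layer[OF Suc.prems] obtain t f u v C D where
    W: "W t f = su2 u v" and CD: "degree C \<le> L" "degree D \<le> L"
    "\<And>z. cmod z = 1 \<Longrightarrow> (cmod (poly C z))\<^sup>2 + (cmod (poly D z))\<^sup>2 = 1"
    and AB: "\<And>z. poly A z = u * poly C z - cnj v * (z * poly D z)"
    "\<And>z. poly B z = v * poly C z + cnj u * (z * poly D z)"
    by metis
  obtain \<theta> \<psi> \<phi> where U: "\<And>x. U_WZW \<psi> \<theta> \<phi> L x =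
      su2 (cis (- (real L * x / 2)) * poly C (cis x)) (cis (- (real L * x / 2)) * poly D (cis x))"
    using Suc.IH[OF CD] by blast
  \<comment> \<open>The stripped layer goes to index \<open>Suc L\<close>, which the inner circuit
    never reads.\<close>
  have "U_WZW \<psi> (\<theta>(Suc L := t)) (\<phi>(Suc L := f)) (Suc L) x =
      su2 (cis (- (real (Suc L) * x / 2)) * poly A (cis x))
          (cis (- (real (Suc L) * x / 2)) * poly B (cis x))" for x
  proof -
    have "U_WZW \<psi> (\<theta>(Suc L := t)) (\<phi>(Suc L := f)) L x = U_WZW \<psi> \<theta> \<phi> L x"
      by (rule U_WZW_cong) auto
    then show ?thesis
      by (simp only: U_WZW.simps fun_upd_same W U AB su2_layer)
  qed
  then show ?case by blast
qed

theorem lemma3: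
  fixes L :: nat and P Q :: "real \<Rightarrow> complex"
  shows "(\<exists>(\<theta>::nat \<Rightarrow> real) (\<phi>'::real) (\<phi>::nat \<Rightarrow> real). \<forall>x.
            U_WZW \<phi>' \<theta> \<phi> L x = mat2 (P x) (- Q x) (cnj (Q x)) (cnj (P x)))
    \<longleftrightarrow>
      P \<in> laurent_polys \<and> Q \<in> laurent_polys \<and>
      laurent_degree P \<le> L \<and> laurent_degree Q \<le> L \<and>
      has_parity P (L mod 2) \<and> has_parity Q (L mod 2) \<and>
      (\<forall>x. (cmod (P x))\<^sup>2 + (cmod (Q x))\<^sup>2 = 1)"
    (is "?lhs \<longleftrightarrow> ?rhs")
proof -
  let ?form = "\<lambda>F A. degree A \<le> L \<and> (\<forall>x. F x = cis (- (real L * x / 2)) * poly A (cis x))"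
  have mat: "mat2 (P x) (- Q x) (cnj (Q x)) (cnj (P x)) = su2 (P x) (- Q x)" for x
    by (simp add: su2_def)
  have rhs: "?rhs \<longleftrightarrow> (\<exists>A. ?form P A) \<and> (\<exists>B. ?form Q B) \<and>
      (\<forall>x. (cmod (P x))\<^sup>2 + (cmod (Q x))\<^sup>2 = 1)"
    unfolding laurent_poly_form_iff[symmetric] by blast
  show ?thesis
  proof
    assume ?lhs
    then obtain \<theta> \<psi> \<phi> where U: "\<And>x. U_WZW \<psi> \<theta> \<phi> L x = su2 (P x) (- Q x)"
      unfolding mat by blast
    obtain A B where AB: "degree A \<le> L" "degree B \<le> L"
      "\<And>x. (cmod (poly A (cis x)))\<^sup>2 + (cmod (poly B (cis x)))\<^sup>2 = 1"
      "\<And>x. U_WZW \<psi> \<theta> \<phi> L x =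
        su2 (cis (- (real L * x / 2)) * poly A (cis x)) (cis (- (real L * x / 2)) * poly B (cis x))"
      using U_WZW_form by metis
    \<comment> \<open>The upper right entry is - Q, so the polynomial of Q is
      \<open>- B\<close>.\<close>
    have P: "P x = cis (- (real L * x / 2)) * poly A (cis x)"
      and Q: "Q x = cis (- (real L * x / 2)) * poly (- B) (cis x)" for x
      using AB(4)[of x] unfolding U su2_eq_iff
      by (auto simp: minus_equation_iff[of "Q x"] dest: sym)
    have "?form P A" "?form Q (- B)" using P Q AB(1,2) by auto
    moreover have "(cmod (P x))\<^sup>2 + (cmod (Q x))\<^sup>2 = 1" for x
      using AB(3)[of x] by (simp add: P Q norm_mult)
    ultimately show ?rhs unfolding rhs by blast
  next
    assume ?rhs
    then obtain A B where AB: "?form P A" "?form Q B"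
      and unit: "\<And>x. (cmod (P x))\<^sup>2 + (cmod (Q x))\<^sup>2 = 1"
      unfolding rhs by blast
    have "(cmod (poly A z))\<^sup>2 + (cmod (poly (- B) z))\<^sup>2 = 1" if "cmod z = 1" for z
    proof -
      \<comment> \<open>The norm identity is known for real x only; every point of the circle is
        some \<open>cis x\<close>.\<close>
      have "z = cis (Arg z)"
        using rcis_cmod_Arg[of z] that by (simp add: rcis_def)
      then show ?thesis
        using unit[of "Arg z"] AB by (simp add: norm_mult)
    qed
    from U_WZW_exists[OF _ _ this, of L] AB obtain \<theta> \<psi> \<phi> where
      "\<And>x. U_WZW \<psi> \<theta> \<phi> L x = su2 (P x) (- Q x)"
      by auto
    then show ?lhs unfolding mat by blast
  qed
qed

end
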